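(* Let $n$ and $r$ be positive integers. Then $A^r_n$ is divisible by $2^{\,n-1-r\cdot d_2(n)}$ (i.e. the $2$-adic valuation of $A^r_n$ is at least $n-1-r\cdot d_2(n)$).
   Context: Write $[m]=\{1,2,\ldots,m\}$ (so $[0]=\emptyset$). For a permutation $\pi$ in the symmetric group $\mathfrak{S}_n$, its descent set is $\mathrm{Des}(\pi)=\{i\in[n-1] : \pi_i>\pi_{i+1}\}$. For $S\subseteq[n-1]$, $\beta_n(S)=|\{\pi\in\mathfrak{S}_n : \mathrm{Des}(\pi)=S\}|$. Define $A^r_n=\sum_{S\subseteq[n-1]}\beta_n(S)^r$. For a positive integer $n$, $u_2(n)$ is the sum of the binary digits of $n$, and $d_2(n)=u_2(n)-1$. If the exponent $n-1-r\cdot d_2(n)$ is negative the assertion is vacuous. *)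

theory Defs
  imports "HOL-Combinatorics.Permutations"
begin

text \<open>
  A permutation of \<open>[n]\<close> is a function \<open>\<pi>\<close> with \<open>\<pi> permutes {1..n}\<close>, so it fixes every number
  outside \<open>{1..n}\<close>. The set \<open>[n - 1]\<close> is \<open>{1..<n}\<close>, which is empty for \<open>n = 1\<close>.
\<close>

definition Des :: "nat \<Rightarrow> (nat \<Rightarrow> nat) \<Rightarrow> nat set" where
  "Des n \<pi> = {i \<in> {1..<n}. \<pi> i > \<pi> (i + 1)}"

definition beta :: "nat \<Rightarrow> nat set \<Rightarrow> nat" where
  "beta n S = card {\<pi>. \<pi> permutes {1..n} \<and> Des n \<pi> = S}"

definition A :: "nat \<Rightarrow> nat \<Rightarrow> nat" where
  "A r n = (\<Sum>S\<in>Pow {1..<n}. beta n S ^ r)"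

text \<open>
  The \<open>i\<close>-th binary digit of \<open>n\<close> is \<open>n div 2 ^ i mod 2\<close>. The range \<open>i < n\<close> covers all nonzero
  digits, because \<open>n < 2 ^ n\<close>.
\<close>

definition u2 :: "nat \<Rightarrow> nat" where
  "u2 n = (\<Sum>i<n. n div 2 ^ i mod 2)"

text \<open>
  The subtraction does not truncate for \<open>n > 0\<close>, where \<open>u2 n \<ge> 1\<close>.
\<close>

definition d2 :: "nat \<Rightarrow> nat" where
  "d2 n = u2 n - 1"

end

theory Submission
  imports Defs
begin

text \<open>
  Let \<open>\<alpha>(T) = (\<Sum>S \<subseteq> T. \<beta>\<^sub>n(S))\<close> count the permutations with descent set inside \<open>T\<close>. It is a
  multinomial coefficient for a composition of \<open>n\<close> into \<open>|T| + 1\<close> positive parts, so by Legendre's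
  formula \<open>2 ^ |T|\<close> divides \<open>2 ^ d\<^sub>2(n) * \<alpha>(T)\<close>. The functions \<open>f\<close> on finite sets for which
  \<open>2 ^ |T|\<close> divides \<open>\<Sum>S \<subseteq> T. f S\<close> for all \<open>T\<close> are closed under pointwise products. Apply this to
  the powers of \<open>2 ^ d\<^sub>2(n) * \<beta>\<^sub>n\<close>.
\<close>

section \<open>Functions with highly divisible subset sums\<close>

text \<open>The values are integers because pairing \<open>S\<close> with \<open>insert x S\<close>
  leads to differences. All \<open>T \<subseteq> X\<close> are included so that the property passes
  to subsets.\<close>

definition subset_sums_dvd :: "'a set \<Rightarrow> ('a set \<Rightarrow> int) \<Rightarrow> bool" where
  "subset_sums_dvd X f \<longleftrightarrow> (\<forall>T\<subseteq>X. 2 ^ card T dvd (\<Sum>S\<in>Pow T. f S))"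

lemma subset_sums_dvdD: "subset_sums_dvd X f \<Longrightarrow> 2 ^ card X dvd (\<Sum>S\<in>Pow X. f S)"
  by (simp add: subset_sums_dvd_def)

lemma subset_sums_dvd_mono: "subset_sums_dvd X f \<Longrightarrow> Y \<subseteq> X \<Longrightarrow> subset_sums_dvd Y f"
  by (auto simp: subset_sums_dvd_def)

lemma sum_Pow_insert:
  assumes "finite X" "x \<notin> X"
  shows "(\<Sum>S\<in>Pow (insert x X). f S) = (\<Sum>S\<in>Pow X. f S + f (insert x S))"
proof -
  have "inj_on (insert x) (Pow X)"
    using assms by (auto simp: inj_on_def)
  moreover have "Pow X \<inter> insert x ` Pow X = {}"
    using assms by auto
  ultimately show ?thesis
    using assms by (simp add: Pow_insert sum.union_disjoint sum.reindex sum.distrib)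
qed

text \<open>Strong induction stands in for Moebius inversion: in the sum over \<open>Pow X\<close>,
  every term except \<open>f X\<close> is already a multiple of \<open>m\<close>.\<close>

lemma dvd_of_dvd_subset_sums:
  fixes f :: "'a set \<Rightarrow> int"
  assumes "finite X" and "\<And>T. T \<subseteq> X \<Longrightarrow> m dvd (\<Sum>S\<in>Pow T. f S)"
  shows "m dvd f X"
  using assms
proof (induction X rule: finite_psubset_induct)
  case (psubset X)
  have "m dvd f S" if "S \<in> Pow X - {X}" for S
    using psubset.IH[of S] psubset.prems that by auto
  then have "m dvd (\<Sum>S\<in>Pow X - {X}. f S)"
    by (rule dvd_sum)
  moreover have "(\<Sum>S\<in>Pow X. f S) = f X + (\<Sum>S\<in>Pow X - {X}. f S)"
    using psubset.hyps by (intro sum.remove) auto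
  ultimately show ?case
    using psubset.prems[of X] by (metis dvd_add_left_iff order_refl)
qed

text \<open>
  The subsets of \<open>insert x X\<close> pair up as \<open>S\<close>, \<open>insert x S\<close>. The sum of \<open>f\<close> over a pair is \<open>2 h\<close>,
  where \<open>h\<close> is again in the class.
\<close>

lemma subset_sums_dvd_insertE:
  assumes "subset_sums_dvd (insert x X) f" "finite X" "x \<notin> X"
  obtains h where "subset_sums_dvd X h"
    and "\<And>S. S \<subseteq> X \<Longrightarrow> f (insert x S) = 2 * h S - f S"
proof -
  define F where "F S = f S + f (insert x S)" for S
  \<comment> \<open>The element \<open>x\<close> raises the exponent by one. This spare factor 2
    makes \<open>F\<close> even and keeps half of \<open>F\<close> in the class.\<close>
  have F: "2 ^ Suc (card T) dvd (\<Sum>S\<in>Pow T. F S)" if "T \<subseteq> X" for T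
  proof -
    have "finite T" "x \<notin> T" "insert x T \<subseteq> insert x X"
      using that assms finite_subset by auto
    then have "2 ^ card (insert x T) dvd (\<Sum>S\<in>Pow (insert x T). f S)"
      using assms(1) by (simp only: subset_sums_dvd_def)
    then show ?thesis
      using \<open>finite T\<close> \<open>x \<notin> T\<close> by (simp add: sum_Pow_insert F_def)
  qed
  have even: "2 dvd F S" if "S \<subseteq> X" for S
  proof (rule dvd_of_dvd_subset_sums)
    show "finite S"
      using that assms(2) finite_subset by blast
    show "2 dvd (\<Sum>R\<in>Pow T. F R)" if "T \<subseteq> S" for T
      using F[of T] that \<open>S \<subseteq> X\<close> by (auto intro: dvd_mult_left)
  qed
  define h where "h S = F S div 2" for S
  show ?thesis
  proof
    show "f (insert x S) = 2 * h S - f S" if "S \<subseteq> X" for S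
      using even[OF that] by (simp add: h_def F_def)
    have "2 ^ card T dvd (\<Sum>S\<in>Pow T. h S)" if "T \<subseteq> X" for T
    proof -
      have "(\<Sum>S\<in>Pow T. F S) = (\<Sum>S\<in>Pow T. 2 * h S)"
        using even that by (intro sum.cong) (auto simp: h_def)
      then show ?thesis
        using F[OF that] by (simp add: sum_distrib_left[symmetric])
    qed
    then show "subset_sums_dvd X h"
      by (simp add: subset_sums_dvd_def)
  qed
qed

text \<open>Induction on \<open>X\<close> for all pairs of functions at once: the step combines
  \<open>f\<close> or its half sum \<open>h\<close> with \<open>g\<close> or its half sum
  \<open>k\<close>.\<close>

lemma dvd_sum_Pow_mult:
  assumes "finite X" "subset_sums_dvd X f" "subset_sums_dvd X g"
  shows "2 ^ card X dvd (\<Sum>S\<in>Pow X. f S * g S)"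
  using assms
proof (induction X arbitrary: f g rule: finite_induct)
  case empty
  then show ?case by simp
next
  case (insert x X)
  obtain h where h: "subset_sums_dvd X h" "\<And>S. S \<subseteq> X \<Longrightarrow> f (insert x S) = 2 * h S - f S"
    using subset_sums_dvd_insertE[OF insert.prems(1) insert.hyps] by blast
  obtain k where k: "subset_sums_dvd X k" "\<And>S. S \<subseteq> X \<Longrightarrow> g (insert x S) = 2 * k S - g S"
    using subset_sums_dvd_insertE[OF insert.prems(2) insert.hyps] by blast
  have f: "subset_sums_dvd X f" and g: "subset_sums_dvd X g"
    using insert.prems subset_sums_dvd_mono by blast+
  let ?s = "\<lambda>p q :: 'a set \<Rightarrow> int. \<Sum>S\<in>Pow X. p S * q S"
  have "(\<Sum>S\<in>Pow (insert x X). f S * g S)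
      = (\<Sum>S\<in>Pow X. f S * g S + f (insert x S) * g (insert x S))"
    using insert.hyps by (rule sum_Pow_insert)
  \<comment> \<open>Expanding \<open>(2 * h S - f S) * (2 * k S - g S)\<close> and adding
    \<open>f S * g S\<close> leaves only even coefficients; the factor 2 accounts for
    \<open>x\<close>.\<close>
  also have "\<dots> = (\<Sum>S\<in>Pow X. 2 * (f S * g S + 2 * (h S * k S) - h S * g S - f S * k S))"
    by (intro sum.cong) (auto simp: h k algebra_simps)
  also have "\<dots> = 2 * (?s f g + 2 * ?s h k - ?s h g - ?s f k)"
    by (simp add: sum_distrib_left sum.distrib sum_subtractf)
  finally have sum: "(\<Sum>S\<in>Pow (insert x X). f S * g S)
      = 2 * (?s f g + 2 * ?s h k - ?s h g - ?s f k)" .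
  have "2 ^ card X dvd ?s f g + 2 * ?s h k - ?s h g - ?s f k"
    using insert.IH[OF f g] insert.IH[OF h(1) k(1)] insert.IH[OF h(1) g] insert.IH[OF f k(1)]
    by (simp add: dvd_add dvd_diff dvd_mult)
  then have "2 * 2 ^ card X dvd (\<Sum>S\<in>Pow (insert x X). f S * g S)"
    unfolding sum by (rule mult_dvd_mono[OF dvd_refl])
  then show ?case
    using insert.hyps by (metis card_insert_disjoint power_Suc)
qed

lemma subset_sums_dvd_power:
  assumes "finite X" "subset_sums_dvd X f"
  shows "subset_sums_dvd X (\<lambda>S. f S ^ r)"
proof (induction r)
  \<comment> \<open>The constant 1 sums to the number of subsets, exactly
    \<open>2 ^ card T\<close>.\<close>
  case 0
  show ?case
    using assms(1) by (auto simp: subset_sums_dvd_def card_Pow dest: finite_subset)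
next
  case (Suc r)
  have "2 ^ card T dvd (\<Sum>S\<in>Pow T. f S * f S ^ r)" if "T \<subseteq> X" for T
    using dvd_sum_Pow_mult[OF finite_subset[OF that assms(1)]
        subset_sums_dvd_mono[OF assms(2) that] subset_sums_dvd_mono[OF Suc that]] .
  then show ?case
    by (simp add: subset_sums_dvd_def)
qed

section \<open>Binary digit sums and binomial coefficients\<close>

lemma u2_rec: "u2 n = u2 (n div 2) + n mod 2"
proof -
  \<comment> \<open>The summation bound in \<open>u2\<close> varies with the argument; padding with
    zero digits makes \<open>n\<close> and \<open>n div 2\<close> comparable.\<close>
  have extend: "u2 m = (\<Sum>i<N. m div 2 ^ i mod 2)" if "m \<le> N" for m N
    unfolding u2_def
  proof (rule sum.mono_neutral_left)
    show "\<forall>i\<in>{..<N} - {..<m}. m div 2 ^ i mod 2 = 0"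
    proof
      fix i assume "i \<in> {..<N} - {..<m}"
      then have "m < 2 ^ i"
        using less_exp[of i] by (auto intro: le_less_trans)
      then show "m div 2 ^ i mod 2 = 0" by simp
    qed
  qed (use that in auto)
  have "u2 n = (\<Sum>i<Suc n. n div 2 ^ i mod 2)"
    by (simp add: extend del: sum.lessThan_Suc)
  also have "\<dots> = n mod 2 + (\<Sum>i<n. n div 2 div 2 ^ i mod 2)"
    by (simp add: sum.lessThan_Suc_shift div_mult2_eq del: sum.lessThan_Suc)
  also have "(\<Sum>i<n. n div 2 div 2 ^ i mod 2) = u2 (n div 2)"
    by (simp add: extend[of "n div 2" n])
  finally show ?thesis by simp
qed

lemma u2_0 [simp]: "u2 0 = 0"
  by (simp add: u2_def)

lemma u2_pos: "n > 0 \<Longrightarrow> u2 n > 0"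
proof (induction n rule: less_induct)
  case (less n)
  show ?case
  proof (cases "n = 1")
    case True
    then show ?thesis by (simp add: u2_def)
  next
    case False
    then have "u2 (n div 2) > 0"
      using less by auto
    then show ?thesis by (simp add: u2_rec[of n])
  qed
qed

text \<open>The even factors of \<open>fact (2 * k)\<close> multiply to
  \<open>2 ^ k * fact k\<close>; \<open>m\<close> is the product of the odd ones.\<close>

lemma fact_double_odd_part: "\<exists>m. odd m \<and> fact (2 * k) = 2 ^ k * fact k * (m :: nat)"
proof (induction k)
  case 0
  show ?case by (auto intro: exI[of _ 1])
next
  case (Suc k)
  then obtain m :: nat where m: "odd m" "fact (2 * k) = 2 ^ k * fact k * m" by blast
  have "fact (2 * Suc k) = 2 ^ Suc k * fact (Suc k) * ((2 * k + 1) * m)"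
    by (simp add: m(2)) (simp add: algebra_simps)
  moreover have "odd ((2 * k + 1) * m)"
    using m(1) by simp
  ultimately show ?case by blast
qed

text \<open>Legendre's formula at the prime 2, in a form without subtraction or valuations.\<close>

lemma fact_two_power_u2: "\<exists>m. odd m \<and> fact n * 2 ^ u2 n = 2 ^ n * (m :: nat)"
proof (induction n rule: less_induct)
  case (less n)
  define k where "k = n div 2"
  show ?case
  proof (cases "n = 0")
    case True
    then show ?thesis by (auto intro: exI[of _ 1])
  next
    case False
    then have "k < n" by (simp add: k_def)
    then obtain m :: nat where m: "odd m" "fact k * 2 ^ u2 k = 2 ^ k * m"
      using less by blast
    obtain l :: nat where l: "odd l" "fact (2 * k) = 2 ^ k * fact k * l"
      using fact_double_odd_part by blast
    have eq: "fact (2 * k) * 2 ^ u2 k = 2 ^ (2 * k) * (m * l)"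
    proof -
      have "fact (2 * k) * 2 ^ u2 k = 2 ^ k * l * (fact k * 2 ^ u2 k)"
        by (simp add: l(2))
      then show ?thesis
        by (simp add: m(2) mult_2 power_add)
    qed
    show ?thesis
    proof (cases "even n")
      case True
      then have "n = 2 * k" "u2 n = u2 k"
        using u2_rec[of n] by (auto simp: k_def)
      then show ?thesis using eq m(1) l(1) by (metis even_mult_iff)
    next
      case False
      then have n: "n = Suc (2 * k)" "u2 n = Suc (u2 k)"
        using u2_rec[of n] by (auto simp: k_def odd_iff_mod_2_eq_one)
      \<comment> \<open>From \<open>2 * k\<close> to \<open>n\<close> the factorial gains only the
        odd factor \<open>n\<close>, while the digit sum and the exponent of \<open>2 ^ n\<close>
        both grow by one.\<close>
      have "fact n * 2 ^ u2 n = 2 * n * (fact (2 * k) * 2 ^ u2 k)"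
        by (simp only: n(2), simp add: n(1) algebra_simps)
      also have "\<dots> = 2 ^ n * (n * (m * l))"
        by (simp add: eq) (simp add: n)
      finally show ?thesis using False m(1) l(1) by (metis even_mult_iff)
    qed
  qed
qed

text \<open>The divisibility half of Kummer's theorem at 2: Legendre's formula is applied to all
  three factorials, and the odd parts \<open>a\<close> and \<open>b\<close> are cancelled by
  coprimality.\<close>

lemma two_power_dvd_binomial:
  assumes "k \<le> n"
  shows "2 ^ (u2 k + u2 (n - k)) dvd 2 ^ u2 n * (n choose k)"
proof -
  obtain a :: nat where a: "odd a" "fact k * 2 ^ u2 k = 2 ^ k * a"
    using fact_two_power_u2 by blast
  obtain b :: nat where b: "odd b" "fact (n - k) * 2 ^ u2 (n - k) = 2 ^ (n - k) * b"
    using fact_two_power_u2 by blast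
  obtain c :: nat where c: "odd c" "fact n * 2 ^ u2 n = 2 ^ n * c"
    using fact_two_power_u2 by blast
  have split: "(2::nat) ^ n = 2 ^ k * 2 ^ (n - k)"
    using assms by (simp flip: power_add)
  have "2 ^ n * (a * b * (2 ^ u2 n * (n choose k)))
      = (2 ^ k * a) * (2 ^ (n - k) * b) * (2 ^ u2 n * (n choose k))"
    by (simp add: split)
  also have "\<dots> = 2 ^ (u2 k + u2 (n - k)) * ((fact k * fact (n - k) * (n choose k)) * 2 ^ u2 n)"
    by (simp add: a(2)[symmetric] b(2)[symmetric] power_add)
  also have "fact k * fact (n - k) * (n choose k) = fact n"
    using assms by (rule binomial_fact_lemma)
  finally have "a * b * (2 ^ u2 n * (n choose k)) = 2 ^ (u2 k + u2 (n - k)) * c"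
    by (simp add: c(2))
  moreover have "coprime (2 ^ (u2 k + u2 (n - k))) (a * b)"
    using a(1) b(1) by simp
  ultimately show ?thesis
    by (metis coprime_dvd_mult_right_iff dvd_triv_left)
qed

section \<open>Arrangements with prescribed possible descents\<close>

text \<open>Lists over an arbitrary \<open>B\<close>, so that prefixes are again of this kind. List
  indices start at 0, hence \<open>Suc i\<close> is the position counted by
  \<open>Des\<close>.\<close>

definition arrangements :: "nat set \<Rightarrow> nat set \<Rightarrow> nat list set" where
  "arrangements B T = {xs. distinct xs \<and> set xs = B \<and>
     (\<forall>i. Suc i < length xs \<longrightarrow> xs ! i > xs ! Suc i \<longrightarrow> Suc i \<in> T)}"

lemma finite_arrangements: "finite B \<Longrightarrow> finite (arrangements B T)"
  by (rule finite_subset[of _ "{xs. set xs = B \<and> distinct xs}"])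
     (auto simp: arrangements_def intro: finite_subset[OF _ finite_subset_distinct[of B]])

lemma arrangements_empty:
  assumes "finite B"
  shows "arrangements B {} = {sorted_list_of_set B}"
proof -
  have "xs \<in> arrangements B {} \<longleftrightarrow> distinct xs \<and> set xs = B \<and> sorted xs" for xs
    by (auto simp: arrangements_def sorted_iff_nth_Suc not_less)
  then show ?thesis
    using assms by (auto simp: sorted_list_of_set_unique sorted_list_of_set.idem_if_sorted_distinct)
qed

text \<open>
  If \<open>t\<close> is the last possible descent, an arrangement is determined by its first \<open>t\<close> entries:
  the remaining ones follow in increasing order.
\<close>

lemma arrangements_insert:
  assumes "finite B" "\<forall>s\<in>T. s < t" "t < card B"
  shows "arrangements B (insert t T) =
    (\<Union>C\<in>{C. C \<subseteq> B \<and> card C = t}. (\<lambda>ys. ys @ sorted_list_of_set (B - C)) ` arrangements C T)"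
    (is "?L = ?R")
proof (intro equalityI subsetI)
  fix xs assume "xs \<in> ?L"
  then have xs: "distinct xs" "set xs = B"
    and desc: "\<And>i. Suc i < length xs \<Longrightarrow> xs ! i > xs ! Suc i \<Longrightarrow> Suc i \<in> insert t T"
    by (auto simp: arrangements_def)
  have len: "length xs = card B"
    using xs distinct_card by fastforce
  define C where "C = set (take t xs)"
  have "card C = t"
    using xs len assms(3) by (simp add: C_def distinct_card)
  have "C \<subseteq> B"
    using xs set_take_subset[of t xs] by (simp add: C_def)
  have "set (drop t xs) = B - C"
    using xs set_take_disj_set_drop_if_distinct[of xs t t]
    by (metis C_def Diff_cancel Un_Diff Un_Diff_Int append_take_drop_id le_refl set_append
        Diff_triv inf_commute sup_bot.left_neutral)
  moreover have "sorted (drop t xs)"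
    unfolding sorted_iff_nth_Suc
  proof (intro allI impI)
    fix i assume i: "Suc i < length (drop t xs)"
    have "Suc (t + i) \<notin> insert t T"
      using assms(2) by auto
    then show "drop t xs ! i \<le> drop t xs ! Suc i"
      using desc[of "t + i"] i by fastforce
  qed
  ultimately have "drop t xs = sorted_list_of_set (B - C)"
    using xs(1) sorted_list_of_set.idem_if_sorted_distinct by (metis distinct_drop)
  then have "xs = take t xs @ sorted_list_of_set (B - C)"
    by (metis append_take_drop_id)
  moreover have "take t xs \<in> arrangements C T"
  proof -
    have "Suc i \<in> T" if "Suc i < length (take t xs)" "take t xs ! i > take t xs ! Suc i" for i
      using desc[of i] that by auto
    then show ?thesis
      using xs by (auto simp: arrangements_def C_def)
  qed
  ultimately show "xs \<in> ?R"
    using \<open>card C = t\<close> \<open>C \<subseteq> B\<close> by blast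
next
  fix xs assume "xs \<in> ?R"
  then obtain C ys where C: "C \<subseteq> B" "card C = t" and ys: "ys \<in> arrangements C T"
    and xs: "xs = ys @ sorted_list_of_set (B - C)"
    by blast
  define zs where "zs = sorted_list_of_set (B - C)"
  have "finite (B - C)" using assms by simp
  have "length ys = t"
    using ys C(2) distinct_card by (fastforce simp: arrangements_def)
  have "Suc i \<in> insert t T" if i: "Suc i < length xs" "xs ! i > xs ! Suc i" for i
  proof -
    \<comment> \<open>A descent lies inside the prefix, at the junction \<open>t\<close>, or inside
      the increasing suffix, where none can occur.\<close>
    consider "Suc i < t" | "Suc i = t" | "Suc i > t" by linarith
    then show ?thesis
    proof cases
      case 1
      then show ?thesis
        using i ys \<open>length ys = t\<close> by (auto simp: xs nth_append arrangements_def)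
    next
      case 2
      then show ?thesis by simp
    next
      case 3
      then have "zs ! (i - t) > zs ! Suc (i - t)" "Suc (i - t) < length zs"
        using i \<open>length ys = t\<close> by (auto simp: xs zs_def nth_append Suc_diff_le)
      moreover have "sorted zs" by (simp add: zs_def)
      ultimately show ?thesis
        by (meson leD sorted_iff_nth_Suc)
    qed
  qed
  then show "xs \<in> ?L"
    using C(1) ys \<open>finite (B - C)\<close> by (auto simp: arrangements_def xs)
qed

lemma card_arrangements_insert:
  assumes "finite B" "\<forall>s\<in>T. s < t" "t < card B"
    and eq: "\<And>C. C \<subseteq> B \<Longrightarrow> card C = t \<Longrightarrow> card (arrangements C T) = c"
  shows "card (arrangements B (insert t T)) = (card B choose t) * c"
proof -
  let ?I = "{C. C \<subseteq> B \<and> card C = t}"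
  let ?F = "\<lambda>C. (\<lambda>ys. ys @ sorted_list_of_set (B - C)) ` arrangements C T"
  \<comment> \<open>The first \<open>t\<close> entries recover \<open>C\<close>, so the images for
    different \<open>C\<close> are disjoint.\<close>
  have prefix: "set (take t xs) = C" if C: "card C = t" "xs \<in> ?F C" for C xs
  proof -
    obtain ys where "ys \<in> arrangements C T" "xs = ys @ sorted_list_of_set (B - C)"
      using C(2) by blast
    moreover from this have "length ys = t" "set ys = C"
      using C(1) distinct_card by (fastforce simp: arrangements_def)+
    ultimately show ?thesis by simp
  qed
  have "card (arrangements B (insert t T)) = card (\<Union>C\<in>?I. ?F C)"
    using assms(1-3) by (simp only: arrangements_insert)
  also have "\<dots> = (\<Sum>C\<in>?I. card (?F C))"
  proof (rule card_UN_disjoint)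
    show "finite ?I" using assms(1) by simp
    show "\<forall>C\<in>?I. finite (?F C)"
      using assms(1) finite_arrangements finite_subset by blast
    show "\<forall>C\<in>?I. \<forall>D\<in>?I. C \<noteq> D \<longrightarrow> ?F C \<inter> ?F D = {}"
      using prefix by blast
  qed
  also have "\<dots> = (\<Sum>C\<in>?I. c)"
    using eq by (intro sum.cong) (auto simp: card_image inj_on_def)
  also have "\<dots> = (card B choose t) * c"
    using assms(1) by (simp add: n_subsets)
  finally show ?thesis .
qed

text \<open>Induction on the largest element of \<open>T\<close>, which cuts off the last of the
  \<open>Suc (card T)\<close> blocks. Each block is nonempty, so its length has a positive digit sum
  and supplies a factor 2.\<close>

lemma card_arrangements_dvd:
  assumes "finite T" "T \<subseteq> {1..<n}" "n > 0"
  obtains c where "\<And>B. finite B \<Longrightarrow> card B = n \<Longrightarrow> card (arrangements B T) = c"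
    and "2 ^ Suc (card T) dvd 2 ^ u2 n * c"
  using assms
proof (induction T arbitrary: n thesis rule: finite_linorder_max_induct)
  case empty
  have "2 ^ Suc (card {}) dvd 2 ^ u2 n * (1::nat)"
    using u2_pos[OF empty.prems(3)] by (simp add: dvd_power)
  then show ?case
    using empty.prems(1)[of 1] by (simp add: arrangements_empty)
next
  case (insert t T)
  have t: "0 < t" "t < n"
    using insert.prems by auto
  moreover have "T \<subseteq> {1..<t}"
    using insert.prems insert.hyps by auto
  ultimately obtain c where c: "\<And>B. finite B \<Longrightarrow> card B = t \<Longrightarrow> card (arrangements B T) = c"
    and dvd: "2 ^ Suc (card T) dvd 2 ^ u2 t * c"
    using insert.IH by blast
  obtain q where q: "2 ^ u2 n * (n choose t) = 2 ^ (u2 t + u2 (n - t)) * q"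
    using two_power_dvd_binomial[of t n] t by (auto elim: dvdE)
  show ?case
  proof (rule insert.prems(1))
    show "card (arrangements B (insert t T)) = (n choose t) * c" if "finite B" "card B = n" for B
      using that t insert.hyps c card_arrangements_insert[of B T t c] finite_subset by metis
    \<comment> \<open>The new factor 2 comes from the last block, since \<open>u2 (n - t)\<close> is
      positive.\<close>
    have "2 * 2 ^ Suc (card T) dvd 2 ^ u2 (n - t) * (2 ^ u2 t * c)"
      using dvd u2_pos[of "n - t"] t by (intro mult_dvd_mono) (auto simp: dvd_power)
    then have "2 * 2 ^ Suc (card T) dvd 2 ^ u2 (n - t) * (2 ^ u2 t * c) * q"
      by (rule dvd_mult2)
    also have "\<dots> = 2 ^ u2 n * ((n choose t) * c)"
      using q by (simp add: power_add algebra_simps)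
    finally show "2 ^ Suc (card (insert t T)) dvd 2 ^ u2 n * ((n choose t) * c)"
      using insert.hyps by (subst card_insert_disjoint) auto
  qed
qed

section \<open>Permutations and the descent set statistic\<close>

lemma bij_betw_permutations_arrangements:
  "bij_betw (\<lambda>\<pi>. map \<pi> [1..<Suc n]) {\<pi>. \<pi> permutes {1..n} \<and> Des n \<pi> \<subseteq> T} (arrangements {1..n} T)"
  unfolding bij_betw_def
proof (intro conjI equalityI subsetI)
  show "inj_on (\<lambda>\<pi>. map \<pi> [1..<Suc n]) {\<pi>. \<pi> permutes {1..n} \<and> Des n \<pi> \<subseteq> T}"
  proof (rule inj_onI, rule ext)
    fix \<pi> \<sigma> i
    assume asm: "\<pi> \<in> {\<pi>. \<pi> permutes {1..n} \<and> Des n \<pi> \<subseteq> T}"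
      "\<sigma> \<in> {\<pi>. \<pi> permutes {1..n} \<and> Des n \<pi> \<subseteq> T}" "map \<pi> [1..<Suc n] = map \<sigma> [1..<Suc n]"
    show "\<pi> i = \<sigma> i"
    proof (cases "i \<in> {1..n}")
      case True
      then have "i \<in> set [1..<Suc n]" by auto
      then show ?thesis using asm(3) by (meson map_eq_conv)
    next
      case False
      then show ?thesis using asm(1,2) by (metis mem_Collect_eq permutes_not_in)
    qed
  qed
next
  fix xs assume "xs \<in> (\<lambda>\<pi>. map \<pi> [1..<Suc n]) ` {\<pi>. \<pi> permutes {1..n} \<and> Des n \<pi> \<subseteq> T}"
  then obtain \<pi> where \<pi>: "\<pi> permutes {1..n}" "Des n \<pi> \<subseteq> T" and xs: "xs = map \<pi> [1..<Suc n]"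
    by blast
  have "distinct xs"
    using permutes_inj_on[OF \<pi>(1)] by (simp add: xs distinct_map del: upt_Suc)
  moreover have "set xs = {1..n}"
    using permutes_image[OF \<pi>(1)] by (simp add: xs atLeastLessThanSuc_atLeastAtMost del: upt_Suc)
  moreover have "Suc i \<in> T" if "Suc i < length xs" "xs ! i > xs ! Suc i" for i
    using that \<pi>(2) by (auto simp: xs Des_def simp del: upt_Suc)
  ultimately show "xs \<in> arrangements {1..n} T"
    by (simp add: arrangements_def)
next
  fix xs assume "xs \<in> arrangements {1..n} T"
  then have xs: "distinct xs" "set xs = {1..n}"
    and desc: "\<And>i. Suc i < length xs \<Longrightarrow> xs ! i > xs ! Suc i \<Longrightarrow> Suc i \<in> T"
    by (auto simp: arrangements_def)
  have len: "length xs = n"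
    using distinct_card[OF xs(1)] xs(2) by simp
  \<comment> \<open>The inverse of passing to one-line notation: shift the index by one and fix
    everything outside \<open>{1..n}\<close>.\<close>
  define \<pi> where "\<pi> i = (if i \<in> {1..n} then xs ! (i - 1) else i)" for i
  have map: "map \<pi> [1..<Suc n] = xs"
    by (rule nth_equalityI) (auto simp: len \<pi>_def simp del: upt_Suc)
  have "\<pi> permutes {1..n}"
  proof (rule bij_imp_permutes)
    have "inj_on \<pi> (set [1..<Suc n])" "\<pi> ` set [1..<Suc n] = {1..n}"
      using xs map by (metis distinct_map, metis set_map)
    then show "bij_betw \<pi> {1..n} {1..n}"
      by (simp add: bij_betw_def atLeastLessThanSuc_atLeastAtMost del: upt_Suc)
    show "\<pi> i = i" if "i \<notin> {1..n}" for i
      using that by (auto simp: \<pi>_def)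
  qed
  moreover have "Des n \<pi> \<subseteq> T"
  proof
    fix i assume "i \<in> Des n \<pi>"
    then show "i \<in> T"
      using desc[of "i - 1"] by (auto simp: Des_def \<pi>_def len)
  qed
  ultimately show "xs \<in> (\<lambda>\<pi>. map \<pi> [1..<Suc n]) ` {\<pi>. \<pi> permutes {1..n} \<and> Des n \<pi> \<subseteq> T}"
    using map by blast
qed

text \<open>Permutations with descents inside \<open>T\<close> are classified by their exact descent
  set.\<close>

lemma sum_beta_Pow:
  assumes "finite T"
  shows "(\<Sum>S\<in>Pow T. beta n S) = card (arrangements {1..n} T)"
proof -
  have "card (arrangements {1..n} T) = card {\<pi>. \<pi> permutes {1..n} \<and> Des n \<pi> \<subseteq> T}"
    using bij_betw_same_card[OF bij_betw_permutations_arrangements[of n T]] by simp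
  also have "{\<pi>. \<pi> permutes {1..n} \<and> Des n \<pi> \<subseteq> T}
      = (\<Union>S\<in>Pow T. {\<pi>. \<pi> permutes {1..n} \<and> Des n \<pi> = S})"
    by auto
  also have "card \<dots> = (\<Sum>S\<in>Pow T. beta n S)"
    unfolding beta_def using assms
    by (intro card_UN_disjoint) (auto intro: finite_subset[OF _ finite_permutations[of "{1..n}"]])
  finally show ?thesis by simp
qed

lemma subset_sums_dvd_beta:
  assumes "n > 0"
  shows "subset_sums_dvd {1..<n} (\<lambda>S. 2 ^ d2 n * int (beta n S))"
  unfolding subset_sums_dvd_def
proof (intro allI impI)
  fix T assume T: "T \<subseteq> {1..<n}"
  then have "finite T"
    using finite_subset by blast
  then have "2 ^ Suc (card T) dvd 2 ^ u2 n * card (arrangements {1..n} T)"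
    using card_arrangements_dvd[OF _ T assms] by (metis card_atLeastAtMost diff_Suc_1 finite_atLeastAtMost)
  \<comment> \<open>One factor 2 cancels on both sides: blocks outnumber the elements of
    \<open>T\<close> by one, as \<open>u2 n\<close> exceeds \<open>d2 n\<close> by one.\<close>
  moreover have "u2 n = Suc (d2 n)"
    using u2_pos[OF assms] by (simp add: d2_def)
  ultimately have "2 ^ card T dvd 2 ^ d2 n * (\<Sum>S\<in>Pow T. beta n S)"
    by (simp add: sum_beta_Pow[OF \<open>finite T\<close>])
  then have "int (2 ^ card T) dvd int (2 ^ d2 n * (\<Sum>S\<in>Pow T. beta n S))"
    by (simp only: of_nat_dvd_iff)
  then show "2 ^ card T dvd (\<Sum>S\<in>Pow T. 2 ^ d2 n * int (beta n S))"
    by (simp add: sum_distrib_left)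
qed

theorem theorem4p6:
  fixes n r :: nat
  assumes "n > 0" and "r > 0"
  shows "2 ^ (n - 1 - r * d2 n) dvd A r n"
proof -
  have "2 ^ (n - 1) dvd (\<Sum>S\<in>Pow {1..<n}. (2 ^ d2 n * int (beta n S)) ^ r)"
    using subset_sums_dvdD[OF subset_sums_dvd_power[OF _ subset_sums_dvd_beta[OF assms(1)]]]
    by simp
  also have "\<dots> = int (2 ^ (r * d2 n) * A r n)"
    by (simp add: A_def power_mult_distrib sum_distrib_left mult.commute flip: power_mult)
  finally have "int (2 ^ (n - 1)) dvd int (2 ^ (r * d2 n) * A r n)"
    by simp
  then have dvd: "2 ^ (n - 1) dvd 2 ^ (r * d2 n) * A r n"
    by (simp only: of_nat_dvd_iff)
  \<comment> \<open>If \<open>r * d2 n\<close> exceeds \<open>n - 1\<close>, truncated subtraction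
    gives exponent 0 and the divisor is 1.\<close>
  show ?thesis
  proof (cases "r * d2 n \<le> n - 1")
    case True
    then have "(2::nat) ^ (n - 1) = 2 ^ (r * d2 n) * 2 ^ (n - 1 - r * d2 n)"
      by (simp flip: power_add)
    then show ?thesis
      using dvd by simp
  qed simp
qed

end
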